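(* Let $G$ be a finite (not necessarily abelian) group, written multiplicatively, and let $p(G)$ be the smallest prime dividing the order of $G$. Let $A, B \subseteq G$ with $|A| = k$ and $|B| = l$, where $k, l \geq 3$, and suppose that $p(G) > k + l - 2$. Suppose further that $A$ is a right geometric progression and $B$ is a left geometric progression with the same common ratio, i.e. there are $a, b, d \in G$ with $$A = \{a d^s \mid 0 \le s \le k-1\}, \qquad B = \{d^t b \mid 0 \le t \le l-1\}.$$ If $|A \overset{\iota}{\cdot} B| = |A| + |B| - 3$, then $A$ and $B$ have the same endpoints, i.e. $a = b$ and $a d^{k-1} = d^{l-1} b$.
   Context: For subsets $A, B$ of a group $G$, the restricted product set (with respect to the identity automorphism $\iota$) is $A \overset{\iota}{\cdot} B := \{ab \mid a \in A,\ b \in B,\ a \neq b\}$. The endpoints of the right progression $A = \{a d^s \mid 0 \le s \le k-1\}$ are its first endpoint $a$ and last endpoint $a d^{k-1}$; the endpoints of the left progression $B = \{d^t b \mid 0 \le t \le l-1\}$ are its first endpoint $b$ and last endpoint $d^{l-1} b$. "Same endpoints" means that the first endpoints coincide and the last endpoints coincide. *)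

theory Defs
  imports "HOL-Algebra.Coset" "HOL-Computational_Algebra.Primes"
begin

(* For the trivial group no prime divides the order and the value is unspecified. *)
definition smallest_prime_dvd_order :: "('a, 'b) monoid_scheme \<Rightarrow> nat" where
  "smallest_prime_dvd_order G = (LEAST p. prime p \<and> p dvd order G)"

(* The condition a \<noteq> b is a \<noteq> \<iota> b, with \<iota> the identity automorphism. *)
definition restricted_product ::
    "('a, 'b) monoid_scheme \<Rightarrow> 'a set \<Rightarrow> 'a set \<Rightarrow> 'a set" where
  "restricted_product G A B = {a \<otimes>\<^bsub>G\<^esub> b | a b. a \<in> A \<and> b \<in> B \<and> a \<noteq> b}"

definition right_progression ::
    "('a, 'b) monoid_scheme \<Rightarrow> 'a \<Rightarrow> 'a \<Rightarrow> nat \<Rightarrow> 'a set" where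
  "right_progression G a d k = {a \<otimes>\<^bsub>G\<^esub> (d [^]\<^bsub>G\<^esub> s) | s::nat. s \<le> k - 1}"

definition left_progression ::
    "('a, 'b) monoid_scheme \<Rightarrow> 'a \<Rightarrow> 'a \<Rightarrow> nat \<Rightarrow> 'a set" where
  "left_progression G d b l = {(d [^]\<^bsub>G\<^esub> t) \<otimes>\<^bsub>G\<^esub> b | t::nat. t \<le> l - 1}"

end

theory Submission
  imports Defs "HOL-Algebra.Multiplicative_Group"
begin

text \<open>
  Put \<open>P n = a d\<^sup>n b\<close>. Since \<open>d \<noteq> 1\<close>, its order is at least \<open>p(G) > k + l - 2\<close>, so the \<open>k + l - 1\<close>
  products \<open>P 0, \<dots>, P (k + l - 2)\<close> are distinct, and exactly two of them are missing from the
  restricted product. If \<open>P n\<close> is missing and \<open>0 < n < k + l - 2\<close>, then \<open>n\<close> has two adjacent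
  representations \<open>s + t = (s + 1) + (t - 1)\<close>, and \<open>a d\<^sup>s = d\<^sup>t b\<close>, \<open>a d\<^sup>s\<^sup>+\<^sup>1 = d\<^sup>t\<^sup>-\<^sup>1 b\<close> together give
  \<open>d b d = b\<close>. So conjugation by \<open>b\<close> inverts \<open>d\<close>, which is impossible in a group of odd order unless
  \<open>d = 1\<close>. Hence \<open>P 0\<close> and \<open>P (k + l - 2)\<close> are the missing products, which says that the endpoints
  agree.
\<close>

lemma (in group) smallest_prime_dvd_order_le:
  assumes "prime q" "q dvd order G"
  shows "smallest_prime_dvd_order G \<le> q"
  unfolding smallest_prime_dvd_order_def using assms by (intro Least_le) simp

text \<open>By Lagrange, any prime factor of \<open>ord x\<close> divides the group order.\<close>

lemma (in group) smallest_prime_dvd_order_le_ord: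
  assumes "finite (carrier G)" "x \<in> carrier G" "x \<noteq> \<one>"
  shows "smallest_prime_dvd_order G \<le> ord x"
proof -
  have "ord x \<noteq> 1" using assms ord_eq_1 by blast
  then obtain q where q: "prime q" "q dvd ord x" using prime_factor_nat by blast
  with assms have "smallest_prime_dvd_order G \<le> q"
    by (meson smallest_prime_dvd_order_le dvd_trans ord_dvd_group_order)
  also have "q \<le> ord x" using q ord_ge_1[OF assms(1,2)] by (simp add: dvd_imp_le)
  finally show ?thesis .
qed

lemma (in monoid) pow_mult_self:
  "x \<in> carrier G \<Longrightarrow> (x \<otimes> x) [^] (m::nat) = x [^] (2 * m)"
  using nat_pow_pow[of x 2 m] by (simp add: numeral_2_eq_2)

text \<open>Applying the relation twice shows that \<open>y \<otimes> y\<close> commutes with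
  \<open>x\<close>. In odd order \<open>2 * m + 1\<close> its power \<open>y [^] (2 * m)\<close> is
  \<open>inv y\<close>, so \<open>y\<close> itself commutes with \<open>x\<close>. The relation then
  reduces to \<open>x \<otimes> x = \<one>\<close>, and odd order forces
  \<open>x = \<one>\<close>.\<close>

lemma (in group) odd_order_inverted_imp_one:
  assumes "odd (order G)" and x: "x \<in> carrier G" and y: "y \<in> carrier G"
    and xyx: "x \<otimes> y \<otimes> x = y"
  shows "x = \<one>"
proof -
  obtain m where m: "order G = 2 * m + 1" using assms(1) oddE by blast
  have "(y \<otimes> y) \<otimes> x = (x \<otimes> y \<otimes> x) \<otimes> y \<otimes> x" using xyx by simp
  also have "\<dots> = x \<otimes> y \<otimes> (x \<otimes> y \<otimes> x)" using x y by (simp add: m_assoc)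
  also have "\<dots> = x \<otimes> (y \<otimes> y)" using xyx x y by (simp add: m_assoc)
  finally have "(y \<otimes> y) [^] m \<otimes> x = x \<otimes> (y \<otimes> y) [^] m"
    using x y group_commutes_pow by simp
  then have "y [^] (2 * m) \<otimes> x = x \<otimes> y [^] (2 * m)"
    using y by (simp add: pow_mult_self)
  moreover have "y [^] (2 * m) = inv y"
    using pow_order_eq_1[OF y] m y by (simp add: inv_equality)
  ultimately have "y \<otimes> (inv y \<otimes> x) \<otimes> y = y \<otimes> (x \<otimes> inv y) \<otimes> y" by simp
  moreover have "y \<otimes> (inv y \<otimes> x) \<otimes> y = x \<otimes> y" using x y by (simp flip: m_assoc)
  moreover have "y \<otimes> (x \<otimes> inv y) \<otimes> y = y \<otimes> x" using x y by (simp add: m_assoc)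
  ultimately have "x \<otimes> y = y \<otimes> x" by simp
  then have "y \<otimes> (x \<otimes> x) = y" using xyx x y by (simp add: m_assoc[symmetric])
  then have "x \<otimes> x = \<one>" using x y by (simp add: r_cancel_one')
  then have "x [^] (2 * m) = \<one>" using x by (simp flip: pow_mult_self)
  then show ?thesis using pow_order_eq_1[OF x] m x by simp
qed

lemma (in group) progression_product:
  assumes "a \<in> carrier G" "b \<in> carrier G" "d \<in> carrier G"
  shows "(a \<otimes> d [^] (s::nat)) \<otimes> (d [^] (t::nat) \<otimes> b) = a \<otimes> d [^] (s + t) \<otimes> b"
  using assms by (simp add: m_assoc nat_pow_mult[symmetric])

text \<open>Multiplying the first coincidence by \<open>d\<close> on the right gives the left side
  of the second; then \<open>d [^] t\<close> cancels.\<close>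

lemma (in group) adjacent_coincidences:
  assumes G: "a \<in> carrier G" "b \<in> carrier G" "d \<in> carrier G"
    and "a \<otimes> d [^] (s::nat) = d [^] Suc t \<otimes> b" "a \<otimes> d [^] Suc s = d [^] (t::nat) \<otimes> b"
  shows "d \<otimes> b \<otimes> d = b"
proof -
  have "d [^] t \<otimes> b = (a \<otimes> d [^] s) \<otimes> d" using assms(5) G by (simp add: m_assoc)
  also have "\<dots> = d [^] t \<otimes> (d \<otimes> b \<otimes> d)"
    unfolding assms(4) using G by (simp add: m_assoc)
  finally show ?thesis using G by simp
qed

theorem theorem6p1:
  fixes G (structure) and A B :: "'a set" and a b d :: 'a and k l :: nat
  assumes "group G" and "finite (carrier G)"
    and "A \<subseteq> carrier G" and "B \<subseteq> carrier G"
    and "card A = k" and "card B = l"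
    and "k \<ge> 3" and "l \<ge> 3"
    and "smallest_prime_dvd_order G > k + l - 2"
    and "a \<in> carrier G" and "b \<in> carrier G" and "d \<in> carrier G"
    and "A = right_progression G a d k"
    and "B = left_progression G d b l"
    and "card (restricted_product G A B) = card A + card B - 3"
  shows "a = b \<and> a \<otimes> d [^] (k - 1) = d [^] (l - 1) \<otimes> b"
proof -
  interpret group G by fact
  note G = \<open>a \<in> carrier G\<close> \<open>b \<in> carrier G\<close> \<open>d \<in> carrier G\<close>
  note kl = \<open>k \<ge> 3\<close> \<open>l \<ge> 3\<close>
  define N where "N = k + l - 2"
  define P where "P n = a \<otimes> d [^] n \<otimes> b" for n :: nat
  define R where "R = restricted_product G A B"
  define M where "M = {n. n \<le> N \<and> P n \<notin> R}"
  have d1: "d \<noteq> \<one>"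
  proof
    assume "d = \<one>"
    then have "A \<subseteq> {a}" using G \<open>A = right_progression G a d k\<close>
      by (auto simp: right_progression_def)
    then have "card A \<le> 1" using card_mono[of "{a}" A] by simp
    then show False using \<open>card A = k\<close> kl by simp
  qed
  have "ord d > N"
    using smallest_prime_dvd_order_le_ord[OF assms(2) G(3) d1] assms(9)
    by (simp add: N_def)
  then have "inj_on (\<lambda>n. d [^] n) {..N}"
    by (intro inj_on_subset[OF ord_inj[OF G(3)]]) auto
  then have inj: "inj_on P {..N}"
    using G by (simp add: inj_on_def P_def)
  \<comment> \<open>Otherwise 2 would divide the order, but the smallest such prime exceeds
    \<open>k + l - 2\<close>, which is at least 4.\<close>
  have "odd (order G)"
    using smallest_prime_dvd_order_le[of 2] assms(9) kl by force
  then have no: "d \<otimes> b \<otimes> d \<noteq> b"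
    using odd_order_inverted_imp_one G d1 by blast
  have R_iff: "x \<in> R \<longleftrightarrow>
    (\<exists>s t. s \<le> k - 1 \<and> t \<le> l - 1 \<and> a \<otimes> d [^] s \<noteq> d [^] t \<otimes> b \<and> x = P (s + t))" for x
    unfolding R_def restricted_product_def assms(13,14) right_progression_def left_progression_def P_def
    using progression_product[OF G] by auto metis+
  \<comment> \<open>A missing product excludes every pair of exponents that represents it, not just
    one.\<close>
  have missing: "a \<otimes> d [^] s = d [^] t \<otimes> b" if "s + t \<in> M" "s \<le> k - 1" "t \<le> l - 1" for s t
    using that R_iff unfolding M_def by blast
  have "R \<subseteq> P ` {..N}"
    using kl by (fastforce simp: R_iff N_def)
  then have "R = P ` ({..N} - M)" by (auto simp: M_def)
  then have "card R = card ({..N} - M)"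
    using card_image[OF inj_on_subset[OF inj]] by (metis Diff_subset)
  moreover have "card ({..N} - M) = Suc N - card M"
    by (subst card_Diff_subset) (auto simp: M_def)
  \<comment> \<open>Here \<open>card R = k + l - 3 = N - 1\<close>, against \<open>N + 1\<close>
    indices.\<close>
  moreover have "card R + 2 = Suc N"
    using assms(5,6,15) kl by (simp add: R_def N_def)
  ultimately have cM: "card M = 2" using kl unfolding N_def by linarith
  have "M \<subseteq> {0, N}"
  proof
    fix n assume n: "n \<in> M"
    show "n \<in> {0, N}"
    proof (rule ccontr)
      assume "n \<notin> {0, N}"
      then have n': "0 < n" "n < N" using n by (auto simp: M_def)
      \<comment> \<open>\<open>Suc t\<close> is the largest exponent of \<open>B\<close> usable for
        \<open>n\<close>, so \<open>s\<close> is the smallest for \<open>A\<close>. From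
        \<open>0 < n\<close> that exponent can drop by one, and \<open>n < N\<close> gives
        \<open>s < k - 1\<close>, so \<open>s\<close> can rise by one.\<close>
      define s where "s = n - min n (l - 1)"
      define t where "t = min n (l - 1) - 1"
      have st: "s + Suc t = n" "Suc s + t = n" "Suc t \<le> l - 1" "Suc s \<le> k - 1"
        using n' kl by (auto simp: s_def t_def N_def)
      then have "a \<otimes> d [^] s = d [^] Suc t \<otimes> b" "a \<otimes> d [^] Suc s = d [^] t \<otimes> b"
        using missing[of s "Suc t"] missing[of "Suc s" t] n by simp_all
      then show False using adjacent_coincidences[OF G] no by blast
    qed
  qed
  moreover have "card {0, N} = 2" using kl by (simp add: N_def)
  ultimately have "M = {0, N}" using cM by (intro card_subset_eq) auto
  moreover have "(k - 1) + (l - 1) = N" using kl by (simp add: N_def)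
  \<comment> \<open>Written as sums of exponents, the two indices fit \<open>missing\<close> at the
    first and the last endpoints.\<close>
  ultimately have "0 + 0 \<in> M" "(k - 1) + (l - 1) \<in> M" by simp_all
  from missing[OF this(1)] missing[OF this(2)] show ?thesis using G by simp
qed

end
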